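(* Let $\mathcal{M}'''_m$ be a meridian surface of parabolic type from the general class, with generating functions $f(u), g(u), \varphi(v)$. Let $K\neq 0$ be a real constant. Then $\mathcal{M}'''_m$ has constant non-zero Gauss curvature $K$ if and only if the meridian $m$ is given by $$f(u)=\alpha\cos(\sqrt{K}\,u)+\beta\sin(\sqrt{K}\,u)\quad\text{if } K>0,$$ $$f(u)=\alpha\cosh(\sqrt{-K}\,u)+\beta\sinh(\sqrt{-K}\,u)\quad\text{if } K<0,$$ where $\alpha$ and $\beta$ are constants, and $g(u)$ is defined by $g'(u)=-\dfrac{1}{2f'(u)}$.
   Context: $\mathbb{R}^4_1$ is the four-dimensional Minkowski space with metric $\langle\cdot,\cdot\rangle$ of signature $(3,1)$ and standard orthonormal frame $\{e_1,e_2,e_3,e_4\}$, $\langle e_1,e_1\rangle=\langle e_2,e_2\rangle=\langle e_3,e_3\rangle=1$, $\langle e_4,e_4\rangle=-1$. Put $\xi_1=\frac{e_3+e_4}{\sqrt2}$, $\xi_2=\frac{-e_3+e_4}{\sqrt2}$, so $\langle\xi_1,\xi_1\rangle=\langle\xi_2,\xi_2\rangle=0$, $\langle\xi_1,\xi_2\rangle=-1$. A meridian surface of parabolic type $\mathcal{M}'''_m$ is the spacelike surface $$z(u,v) = f(u)\,\varphi(v)\cos v\, e_1 + f(u)\,\varphi(v)\sin v\, e_2+ \left(f(u)\frac{\varphi(v)^2}{2}+g(u)\right)\xi_1 + f(u)\,\xi_2,\quad u\in I,\ v\in J,$$ where $I,J\subset\mathbb{R}$ are intervals, $f,g:I\to\mathbb{R}$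 and $\varphi:J\to\mathbb{R}$ are smooth, $f>0$, $-f'g'>0$ on $I$, and $\dot\varphi^2+\varphi^2>0$ on $J$ ($'=d/du$, dot $=d/dv$). The $u$-lines are congruent curves, called the meridians $m$, determined by $f,g$; they are assumed parameterized by arc length, i.e. $-2f'g'=1$. Their curvature is $\kappa_m(u)=\frac{f''(u)}{f'(u)}$. Put $$\kappa(v)=\frac{\varphi\ddot\varphi-2\dot\varphi^2-\varphi^2}{(\dot\varphi^2+\varphi^2)^{3/2}}.$$ The surface is from the general class if $\kappa_m(u)\,\kappa(v)\neq0$ for all $u\in I$, $v\in J$. The Gauss curvature is that of the induced Riemannian metric. *)

theory Defs
  imports "HOL-Analysis.Analysis"
begin

section \<open>Calculus on intervals\<close>

text \<open>Intervals need not be open, so derivatives are taken within the interval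
  (one-sided at an end point that belongs to it).\<close>

definition deriv_on :: "real set \<Rightarrow> (real \<Rightarrow> 'a::real_normed_vector) \<Rightarrow> real \<Rightarrow> 'a"
  where "deriv_on S h x = vector_derivative h (at x within S)"

definition smooth_on_interval :: "real set \<Rightarrow> (real \<Rightarrow> real) \<Rightarrow> bool"
  where "smooth_on_interval S h \<longleftrightarrow> (\<forall>n. (deriv_on S ^^ n) h differentiable_on S)"

definition nondegenerate_interval :: "real set \<Rightarrow> bool"
  where "nondegenerate_interval S \<longleftrightarrow> is_interval S \<and> interior S \<noteq> {}"


section \<open>Gauss curvature of a Riemannian metric on a coordinate rectangle\<close>

text \<open>The rectangle is \<open>I \<times> J\<close> with coordinates \<open>x\<^sup>1 = u\<close>, \<open>x\<^sup>2 = v\<close>.\<close>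

definition partial ::
    "real set \<Rightarrow> real set \<Rightarrow> 2 \<Rightarrow> (real \<Rightarrow> real \<Rightarrow> 'a::real_normed_vector) \<Rightarrow> real \<Rightarrow> real \<Rightarrow> 'a"
  where "partial I J i h u v = (if i = 1 then deriv_on I (\<lambda>s. h s v) u else deriv_on J (\<lambda>t. h u t) v)"

text \<open>\<open>christoffel I J G k i j\<close> is
  \<open>\<Gamma>\<^sup>k\<^sub>i\<^sub>j = 1/2 \<Sum>\<^sub>l G\<^sup>k\<^sup>l (\<partial>\<^sub>i G\<^sub>j\<^sub>l + \<partial>\<^sub>j G\<^sub>i\<^sub>l - \<partial>\<^sub>l G\<^sub>i\<^sub>j)\<close>.\<close>

definition christoffel ::
    "real set \<Rightarrow> real set \<Rightarrow> (real \<Rightarrow> real \<Rightarrow> real^2^2) \<Rightarrow> 2 \<Rightarrow> 2 \<Rightarrow> 2 \<Rightarrow> real \<Rightarrow> real \<Rightarrow> real"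
  where "christoffel I J G k i j u v =
    (\<Sum>l\<in>UNIV. matrix_inv (G u v) $ k $ l *
      (partial I J i (\<lambda>s t. G s t $ j $ l) u v
       + partial I J j (\<lambda>s t. G s t $ i $ l) u v
       - partial I J l (\<lambda>s t. G s t $ i $ j) u v)) / 2"

text \<open>\<open>riemann I J G l k i j\<close> is the \<open>\<partial>\<^sub>l\<close>-component of \<open>R(\<partial>\<^sub>i, \<partial>\<^sub>j) \<partial>\<^sub>k\<close>, where
  \<open>R(X, Y) = \<nabla>\<^sub>X \<nabla>\<^sub>Y - \<nabla>\<^sub>Y \<nabla>\<^sub>X - \<nabla>\<^bsub>[X,Y]\<^esub>\<close>.\<close>

definition riemann ::
    "real set \<Rightarrow> real set \<Rightarrow> (real \<Rightarrow> real \<Rightarrow> real^2^2) \<Rightarrow> 2 \<Rightarrow> 2 \<Rightarrow> 2 \<Rightarrow> 2 \<Rightarrow> real \<Rightarrow> real \<Rightarrow> real"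
  where "riemann I J G l k i j u v =
    partial I J i (christoffel I J G l j k) u v
    - partial I J j (christoffel I J G l i k) u v
    + (\<Sum>m\<in>UNIV. christoffel I J G m j k u v * christoffel I J G l i m u v
                - christoffel I J G m i k u v * christoffel I J G l j m u v)"

text \<open>\<open>K = \<langle>R(\<partial>\<^sub>1, \<partial>\<^sub>2) \<partial>\<^sub>2, \<partial>\<^sub>1\<rangle> / det G\<close>; with this sign round spheres have positive curvature.\<close>

definition gauss_curvature ::
    "real set \<Rightarrow> real set \<Rightarrow> (real \<Rightarrow> real \<Rightarrow> real^2^2) \<Rightarrow> real \<Rightarrow> real \<Rightarrow> real"
  where "gauss_curvature I J G u v =
    (\<Sum>l\<in>UNIV. riemann I J G l 2 1 2 u v * G u v $ l $ 1) / det (G u v)"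


section \<open>Minkowski space and surfaces in it\<close>

definition mink :: "real^4 \<Rightarrow> real^4 \<Rightarrow> real"
  where "mink x y = x$1 * y$1 + x$2 * y$2 + x$3 * y$3 - x$4 * y$4"

definition frame :: "4 \<Rightarrow> real^4"
  where "frame i = axis i 1"

definition \<xi>1 :: "real^4"
  where "\<xi>1 = (frame 3 + frame 4) /\<^sub>R sqrt 2"

definition \<xi>2 :: "real^4"
  where "\<xi>2 = (- frame 3 + frame 4) /\<^sub>R sqrt 2"

definition induced_metric ::
    "real set \<Rightarrow> real set \<Rightarrow> (real \<Rightarrow> real \<Rightarrow> real^4) \<Rightarrow> real \<Rightarrow> real \<Rightarrow> real^2^2"
  where "induced_metric I J z u v =
    (\<chi> i j. mink (partial I J i z u v) (partial I J j z u v))"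

definition surface_gauss_curvature ::
    "real set \<Rightarrow> real set \<Rightarrow> (real \<Rightarrow> real \<Rightarrow> real^4) \<Rightarrow> real \<Rightarrow> real \<Rightarrow> real"
  where "surface_gauss_curvature I J z = gauss_curvature I J (induced_metric I J z)"


section \<open>Meridian surfaces of parabolic type\<close>

definition meridian_param ::
    "(real \<Rightarrow> real) \<Rightarrow> (real \<Rightarrow> real) \<Rightarrow> (real \<Rightarrow> real) \<Rightarrow> real \<Rightarrow> real \<Rightarrow> real^4"
  where "meridian_param f g \<phi> u v =
    (f u * \<phi> v * cos v) *\<^sub>R frame 1 + (f u * \<phi> v * sin v) *\<^sub>R frame 2
    + (f u * ((\<phi> v)\<^sup>2 / 2) + g u) *\<^sub>R \<xi>1 + f u *\<^sub>R \<xi>2"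

text \<open>These conditions make the induced metric \<open>du\<^sup>2 + f\<^sup>2 (\<phi>'\<^sup>2 + \<phi>\<^sup>2) dv\<^sup>2\<close>, so the surface is
  automatically spacelike. The condition \<open>- 2 f' g' = 1\<close> is the arc length parametrization of the
  meridians.\<close>

definition parabolic_meridian_surface ::
    "real set \<Rightarrow> real set \<Rightarrow> (real \<Rightarrow> real) \<Rightarrow> (real \<Rightarrow> real) \<Rightarrow> (real \<Rightarrow> real) \<Rightarrow> bool"
  where "parabolic_meridian_surface I J f g \<phi> \<longleftrightarrow>
    nondegenerate_interval I \<and> nondegenerate_interval J \<and>
    smooth_on_interval I f \<and> smooth_on_interval I g \<and> smooth_on_interval J \<phi> \<and>
    (\<forall>u\<in>I. f u > 0) \<and>
    (\<forall>u\<in>I. - (deriv_on I f u * deriv_on I g u) > 0) \<and>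
    (\<forall>v\<in>J. (deriv_on J \<phi> v)\<^sup>2 + (\<phi> v)\<^sup>2 > 0) \<and>
    (\<forall>u\<in>I. - 2 * deriv_on I f u * deriv_on I g u = 1)"

definition meridian_curvature :: "real set \<Rightarrow> (real \<Rightarrow> real) \<Rightarrow> real \<Rightarrow> real"
  where "meridian_curvature I f u = deriv_on I (deriv_on I f) u / deriv_on I f u"

definition kappa :: "real set \<Rightarrow> (real \<Rightarrow> real) \<Rightarrow> real \<Rightarrow> real"
  where "kappa J \<phi> v =
    (\<phi> v * deriv_on J (deriv_on J \<phi>) v - 2 * (deriv_on J \<phi> v)\<^sup>2 - (\<phi> v)\<^sup>2)
    / ((deriv_on J \<phi> v)\<^sup>2 + (\<phi> v)\<^sup>2) powr (3/2)"

definition general_class ::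
    "real set \<Rightarrow> real set \<Rightarrow> (real \<Rightarrow> real) \<Rightarrow> (real \<Rightarrow> real) \<Rightarrow> bool"
  where "general_class I J f \<phi> \<longleftrightarrow>
    (\<forall>u\<in>I. \<forall>v\<in>J. meridian_curvature I f u * kappa J \<phi> v \<noteq> 0)"

end

theory Submission
  imports Defs
begin

text \<open>The induced metric is the warped product \<open>du\<^sup>2 + f\<^sup>2 (\<phi>'\<^sup>2 + \<phi>\<^sup>2) dv\<^sup>2\<close>, whose Gauss curvature is
  \<open>- f'' / f\<close>. Constant curvature \<open>K\<close> is therefore the linear equation \<open>f'' = - K f\<close>. It is solved by
  noting that the coefficients of \<open>f\<close> with respect to the moving basis of solutions (obtained from
  \<open>f\<close> and \<open>f'\<close> by a rotation, circular or hyperbolic) have derivative zero, hence are constant on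
  the interval.\<close>

section \<open>Derivatives within an interval\<close>

text \<open>Derivatives within \<open>S\<close> are unique only where this filter is nontrivial. A
  connected set that is not a singleton has no isolated points, and a nonempty interior excludes a
  singleton of reals.\<close>

lemma nondegenerate_interval_at_within_neq_bot:
  assumes "nondegenerate_interval S" and "x \<in> S"
  shows "at x within S \<noteq> bot"
proof -
  have "connected S" and "interior S \<noteq> {}"
    using assms(1) by (auto simp: nondegenerate_interval_def is_interval_connected)
  then have "x islimpt S"
    using assms(2) by (intro connected_imp_perfect) auto
  then show ?thesis
    by (simp add: trivial_limit_within)
qed

lemma deriv_on_eqI:
  assumes "nondegenerate_interval S" and "x \<in> S" and "(h has_vector_derivative d) (at x within S)"
  shows "deriv_on S h x = d"
  unfolding deriv_on_def
  by (rule vector_derivative_within[OF nondegenerate_interval_at_within_neq_bot[OF assms(1,2)] assms(3)])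

lemma deriv_on_real_eqI:
  assumes "nondegenerate_interval S" and "x \<in> S" and "(h has_real_derivative d) (at x within S)"
  shows "deriv_on S h x = d"
  using assms by (intro deriv_on_eqI) (simp_all add: has_real_derivative_iff_has_vector_derivative)

text \<open>A derivative within \<open>S\<close> sees values on \<open>S\<close> only.
  \<open>vector_derivative\<close> is a choice among all derivatives, so equivalence of the two
  predicates already gives equality, with no differentiability assumed.\<close>

lemma deriv_on_cong:
  assumes "x \<in> S" and "\<And>y. y \<in> S \<Longrightarrow> h y = k y"
  shows "deriv_on S h x = deriv_on S k x"
proof -
  have "(h has_vector_derivative d) (at x within S) \<longleftrightarrow> (k has_vector_derivative d) (at x within S)" for d
    using assms by (metis has_vector_derivative_transform)
  then show ?thesis
    by (simp add: deriv_on_def vector_derivative_def)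
qed

text \<open>Lets a closed form that is valid only on the rectangle, such as that of a Christoffel
  symbol, be substituted before differentiating.\<close>

lemma partial_cong:
  assumes "u \<in> I" and "v \<in> J" and "\<And>s t. s \<in> I \<Longrightarrow> t \<in> J \<Longrightarrow> h s t = k s t"
  shows "partial I J i h u v = partial I J i k u v"
  unfolding partial_def using assms by (auto intro!: deriv_on_cong)

lemma smooth_on_interval_has_deriv_on:
  assumes "smooth_on_interval S h" and "x \<in> S"
  shows "((deriv_on S ^^ n) h has_real_derivative (deriv_on S ^^ Suc n) h x) (at x within S)"
proof -
  have "(deriv_on S ^^ n) h differentiable (at x within S)"
    using assms by (auto simp: smooth_on_interval_def differentiable_on_def)
  then show ?thesis
    by (simp add: vector_derivative_works deriv_on_def has_real_derivative_iff_has_vector_derivative)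
qed

lemma smooth_on_interval_has_deriv_on_1:
  assumes "smooth_on_interval S h" and "x \<in> S"
  shows "(h has_real_derivative deriv_on S h x) (at x within S)"
  using smooth_on_interval_has_deriv_on[OF assms, of 0] by simp

lemma smooth_on_interval_has_deriv_on_2:
  assumes "smooth_on_interval S h" and "x \<in> S"
  shows "(deriv_on S h has_real_derivative deriv_on S (deriv_on S h) x) (at x within S)"
  using smooth_on_interval_has_deriv_on[OF assms, of 1] by simp


section \<open>Gauss curvature of a warped product\<close>

lemma matrix_inv_diag_2:
  fixes A :: "real^2^2"
  assumes "A $ 1 $ 1 = a" "A $ 2 $ 2 = b" "A $ 1 $ 2 = 0" "A $ 2 $ 1 = 0" and "a \<noteq> 0" "b \<noteq> 0"
  shows "matrix_inv A = (\<chi> i j. if i = j then (if i = 1 then 1 / a else 1 / b) else 0)"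
    (is "_ = ?B")
proof -
  have AB: "A ** ?B = mat 1" and BA: "?B ** A = mat 1"
    using assms by (simp_all add: matrix_matrix_mult_def mat_def vec_eq_iff forall_2 sum_2)
  \<comment> \<open>\<open>matrix_inv\<close> chooses some two-sided inverse, so uniqueness is
    required: \<open>B = B ** (A ** ?B) = (B ** A) ** ?B = ?B\<close>.\<close>
  have "B = ?B" if "A ** B = mat 1 \<and> B ** A = mat 1" for B
    using that AB matrix_mul_assoc[of B A ?B] by simp
  then show ?thesis
    unfolding matrix_inv_def by (rule some_equality[where P = "\<lambda>B. A ** B = mat 1 \<and> B ** A = mat 1", OF conjI[OF AB BA]])
qed

text \<open>The factor \<open>w\<close> depends on \<open>v\<close> alone. For positive
  \<open>w\<close> a change of the \<open>v\<close>-coordinate would turn it into 1, which explains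
  why it cancels from the curvature.\<close>

lemma gauss_curvature_warped_product:
  fixes f f' f'' w w' :: "real \<Rightarrow> real" and G :: "real \<Rightarrow> real \<Rightarrow> real^2^2"
  assumes I: "nondegenerate_interval I" and J: "nondegenerate_interval J"
    and G: "\<And>u v. u \<in> I \<Longrightarrow> v \<in> J \<Longrightarrow>
      G u v = (\<chi> i j. if i = j then (if i = 1 then 1 else (f u)\<^sup>2 * w v) else 0)"
    and f: "\<And>u. u \<in> I \<Longrightarrow> f u \<noteq> 0" and w: "\<And>v. v \<in> J \<Longrightarrow> w v \<noteq> 0"
    and f': "\<And>u. u \<in> I \<Longrightarrow> (f has_real_derivative f' u) (at u within I)"
    and f'': "\<And>u. u \<in> I \<Longrightarrow> (f' has_real_derivative f'' u) (at u within I)"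
    and w': "\<And>v. v \<in> J \<Longrightarrow> (w has_real_derivative w' v) (at v within J)"
    and "u \<in> I" "v \<in> J"
  shows "gauss_curvature I J G u v = - f'' u / f u"
proof -
  have [simp]: "(2::2) \<noteq> 1" "(1::2) \<noteq> 2" by simp_all
  have dG: "partial I J l (\<lambda>s t. G s t $ i $ j) u v =
      (if i = 2 \<and> j = 2 then (if l = 1 then 2 * f u * f' u * w v else (f u)\<^sup>2 * w' v) else 0)"
    if uv: "u \<in> I" "v \<in> J" for u v i j l
  proof -
    have "partial I J l (\<lambda>s t. G s t $ i $ j) u v =
        partial I J l (\<lambda>s t. if i = j then (if i = 1 then 1 else (f s)\<^sup>2 * w t) else 0) u v"
      using uv by (intro partial_cong) (auto simp: G)
    also have "\<dots> = (if i = 2 \<and> j = 2 then (if l = 1 then 2 * f u * f' u * w v else (f u)\<^sup>2 * w' v) else 0)"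
    proof (cases "i = 2 \<and> j = 2")
      case True
      have "deriv_on I (\<lambda>s. (f s)\<^sup>2 * w v) u = 2 * f u * f' u * w v"
        by (rule deriv_on_real_eqI[OF I uv(1)])
           (auto intro!: derivative_eq_intros f' uv simp: power2_eq_square)
      moreover have "deriv_on J (\<lambda>t. (f u)\<^sup>2 * w t) v = (f u)\<^sup>2 * w' v"
        by (rule deriv_on_real_eqI[OF J uv(2)]) (auto intro!: derivative_eq_intros w' uv)
      ultimately show ?thesis
        using True by (simp add: partial_def)
    next
      case False
      have "deriv_on I (\<lambda>s. c) u = 0" "deriv_on J (\<lambda>t. c) v = 0" for c :: real
        by (auto intro!: deriv_on_real_eqI I J uv)
      \<comment> \<open>Away from the entry (2,2), the only diagonal entry is the constant 1 at
        (1,1).\<close>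
      moreover have "(if i = j then (if i = 1 then 1 else x) else 0) = (if i = j then 1 else 0)" for x :: real
        using False exhaust_2[of i] by auto
      ultimately show ?thesis
        using False by (simp only: partial_def if_False if_cancel)
    qed
    finally show ?thesis .
  qed
  have inv: "matrix_inv (G u v) = (\<chi> i j. if i = j then (if i = 1 then 1 / 1 else 1 / ((f u)\<^sup>2 * w v)) else 0)"
    if "u \<in> I" "v \<in> J" for u v
    using that f w by (intro matrix_inv_diag_2) (auto simp: G)
  \<comment> \<open>These closed forms suffice for \<open>riemann I J G 1 2 1 2\<close>: the symbol
    \<open>christoffel I J G 2 2 2\<close> occurs there only multiplied by
    \<open>christoffel I J G 1 1 2\<close>, which is 0.\<close>
  have \<Gamma>: "christoffel I J G 1 1 1 u v = 0" "christoffel I J G 1 1 2 u v = 0"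
    "christoffel I J G 1 2 1 u v = 0" "christoffel I J G 1 2 2 u v = - (f u * f' u * w v)"
    "christoffel I J G 2 1 2 u v = f' u / f u"
    if "u \<in> I" "v \<in> J" for u v
    using that f[of u] w[of v]
    by (simp_all add: christoffel_def sum_2 dG inv power2_eq_square)
  have "partial I J 1 (christoffel I J G 1 2 2) u v = partial I J 1 (\<lambda>s t. - (f s * f' s * w t)) u v"
    using \<open>u \<in> I\<close> \<open>v \<in> J\<close> by (intro partial_cong) (auto simp: \<Gamma>)
  also have "\<dots> = - ((f' u * f' u + f u * f'' u) * w v)"
    by (simp add: partial_def, rule deriv_on_real_eqI[OF I \<open>u \<in> I\<close>])
       (auto intro!: derivative_eq_intros f' f'' \<open>u \<in> I\<close> simp: algebra_simps)
  finally have 1: "partial I J 1 (christoffel I J G 1 2 2) u v = - ((f' u * f' u + f u * f'' u) * w v)" .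
  have "partial I J 2 (christoffel I J G 1 1 2) u v = partial I J 2 (\<lambda>s t. 0) u v"
    using \<open>u \<in> I\<close> \<open>v \<in> J\<close> by (intro partial_cong) (auto simp: \<Gamma>)
  also have "\<dots> = (0::real)"
    unfolding partial_def using \<open>v \<in> J\<close> by (auto intro!: deriv_on_real_eqI[OF J])
  finally have 2: "partial I J 2 (christoffel I J G 1 1 2) u v = 0" .
  \<comment> \<open>In the sum over \<open>m\<close>, the index 1 contributes 0 and the index 2
    contributes \<open>f' u * f' u * w v\<close>, cancelling the same term in the derivative of
    \<open>christoffel I J G 1 2 2\<close>. Since \<open>G\<close> is diagonal, only this component
    enters the Gauss curvature.\<close>
  have "riemann I J G 1 2 1 2 u v = - (f u * f'' u * w v)"
    using \<open>u \<in> I\<close> \<open>v \<in> J\<close> f[of u]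
    by (simp add: riemann_def sum_2 1 2 \<Gamma> algebra_simps)
  then show ?thesis
    using \<open>u \<in> I\<close> \<open>v \<in> J\<close> f[of u] w[of v]
    by (simp add: gauss_curvature_def sum_2 det_2 G power2_eq_square)
qed


section \<open>The induced metric of a parabolic meridian surface\<close>

text \<open>\<xi>1 and \<xi>2 are null, have product -1 and are orthogonal to \<open>frame 1\<close>
  and \<open>frame 2\<close>; hence only the cross terms of \<open>c\<close> and \<open>d\<close>
  appear.\<close>

lemma mink_meridian_frame:
  "mink (a *\<^sub>R frame 1 + b *\<^sub>R frame 2 + c *\<^sub>R \<xi>1 + d *\<^sub>R \<xi>2)
     (a' *\<^sub>R frame 1 + b' *\<^sub>R frame 2 + c' *\<^sub>R \<xi>1 + d' *\<^sub>R \<xi>2) = a * a' + b * b' - c * d' - d * c'"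
proof -
  define r where "r = inverse (sqrt 2)"
  have r: "r * r = 1 / 2"
    by (simp add: r_def field_simps)
  have comp: "(a *\<^sub>R frame 1 + b *\<^sub>R frame 2 + c *\<^sub>R \<xi>1 + d *\<^sub>R \<xi>2) $ 1 = a"
    "(a *\<^sub>R frame 1 + b *\<^sub>R frame 2 + c *\<^sub>R \<xi>1 + d *\<^sub>R \<xi>2) $ 2 = b"
    "(a *\<^sub>R frame 1 + b *\<^sub>R frame 2 + c *\<^sub>R \<xi>1 + d *\<^sub>R \<xi>2) $ 3 = (c - d) * r"
    "(a *\<^sub>R frame 1 + b *\<^sub>R frame 2 + c *\<^sub>R \<xi>1 + d *\<^sub>R \<xi>2) $ 4 = (c + d) * r"
    for a b c d
    by (simp_all add: frame_def \<xi>1_def \<xi>2_def axis_def r_def left_diff_distrib distrib_right)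
  \<comment> \<open>The cancellation of \<open>c * c'\<close> and \<open>d * d'\<close> expresses
    that \<xi>1 and \<xi>2 are null.\<close>
  have "(c - d) * r * ((c' - d') * r) - (c + d) * r * ((c' + d') * r) = - 2 * (c * d' + d * c') * (r * r)"
    by (simp only: algebra_simps)
  moreover have "p + x - y = p - s - t" if "x - y = - 2 * (s + t) * (1 / 2)" for p x y s t :: real
    using that by (simp add: field_simps)
  ultimately show ?thesis
    unfolding mink_def comp r by blast
qed

text \<open>Reduces tangent vectors to four real derivatives and keeps them in the shape to which
  \<open>mink_meridian_frame\<close> applies.\<close>

lemma has_vector_derivative_meridian_frame:
  assumes "(a has_real_derivative a') F" "(b has_real_derivative b') F"
    "(c has_real_derivative c') F" "(d has_real_derivative d') F"
  shows "((\<lambda>x. a x *\<^sub>R frame 1 + b x *\<^sub>R frame 2 + c x *\<^sub>R \<xi>1 + d x *\<^sub>R \<xi>2) has_vector_derivative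
    a' *\<^sub>R frame 1 + b' *\<^sub>R frame 2 + c' *\<^sub>R \<xi>1 + d' *\<^sub>R \<xi>2) F"
  using assms unfolding has_real_derivative_iff_has_vector_derivative has_vector_derivative_def
  by (auto intro!: derivative_eq_intros simp: algebra_simps)

text \<open>Write the surface as f l + g \<xi>1, where l(v) has the coefficients \<phi> cos v,
  \<phi> sin v, \<phi>^2/2, 1. This l is null, so it is orthogonal to its derivative l', and l' has
  no \<xi>2 component, so it is orthogonal to \<xi>1. Thus the \<open>u\<close>-tangent has square
  -2 f' g' = 1, the mixed product vanishes, and the \<open>v\<close>-tangent f l' has square f^2
  (\<phi>'^2 + \<phi>^2).\<close>

lemma induced_metric_meridian_param:
  assumes M: "parabolic_meridian_surface I J f g \<phi>" and "u \<in> I" "v \<in> J"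
  shows "induced_metric I J (meridian_param f g \<phi>) u v =
    (\<chi> i j. if i = j then (if i = 1 then 1 else (f u)\<^sup>2 * ((deriv_on J \<phi> v)\<^sup>2 + (\<phi> v)\<^sup>2)) else 0)"
proof -
  note M' = M[unfolded parabolic_meridian_surface_def]
  have [simp]: "(2::2) \<noteq> 1" "(1::2) \<noteq> 2" by simp_all
  define p q r where "p = deriv_on I f u" and "q = deriv_on I g u" and "r = deriv_on J \<phi> v"
  have f': "(f has_real_derivative p) (at u within I)"
    and g': "(g has_real_derivative q) (at u within I)"
    and \<phi>': "(\<phi> has_real_derivative r) (at v within J)"
    unfolding p_def q_def r_def using M' assms(2,3) by (auto intro: smooth_on_interval_has_deriv_on_1)
  have pq: "- 2 * p * q = 1"
    using M' assms(2) by (auto simp: p_def q_def)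
  have zu: "partial I J 1 (meridian_param f g \<phi>) u v =
      (p * \<phi> v * cos v) *\<^sub>R frame 1 + (p * \<phi> v * sin v) *\<^sub>R frame 2
      + (p * ((\<phi> v)\<^sup>2 / 2) + q) *\<^sub>R \<xi>1 + p *\<^sub>R \<xi>2"
    unfolding partial_def meridian_param_def using M' assms(2)
    by (auto intro!: deriv_on_eqI has_vector_derivative_meridian_frame derivative_eq_intros f' g')
  \<comment> \<open>The zero multiple of \<xi>2 is kept so that the four-term frame pattern
    matches.\<close>
  have zv: "partial I J 2 (meridian_param f g \<phi>) u v =
      (f u * (r * cos v - \<phi> v * sin v)) *\<^sub>R frame 1 + (f u * (r * sin v + \<phi> v * cos v)) *\<^sub>R frame 2
      + (f u * (\<phi> v * r)) *\<^sub>R \<xi>1 + 0 *\<^sub>R \<xi>2"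
  proof -
    have "((\<lambda>t. (f u * \<phi> t * cos t) *\<^sub>R frame 1 + (f u * \<phi> t * sin t) *\<^sub>R frame 2
        + (f u * ((\<phi> t)\<^sup>2 / 2) + g u) *\<^sub>R \<xi>1 + f u *\<^sub>R \<xi>2) has_vector_derivative
      (f u * (r * cos v - \<phi> v * sin v)) *\<^sub>R frame 1 + (f u * (r * sin v + \<phi> v * cos v)) *\<^sub>R frame 2
      + (f u * (\<phi> v * r)) *\<^sub>R \<xi>1 + 0 *\<^sub>R \<xi>2) (at v within J)"
      by (intro has_vector_derivative_meridian_frame)
         (auto intro!: derivative_eq_intros \<phi>' simp: algebra_simps)
    then show ?thesis
      unfolding partial_def meridian_param_def using M' assms(3) by (auto intro!: deriv_on_eqI)
  qed
  have cs: "cos v * cos v + sin v * sin v = 1"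
    using sin_cos_squared_add[of v] by (simp add: power2_eq_square)
  \<comment> \<open>Here and in the next two computations \<open>c\<close> and \<open>s\<close>
    stand for cosine and sine: the identity is polynomial, and the Pythagorean relation enters only
    through the factor containing \<open>c * c + s * s\<close>.\<close>
  have "(p * \<phi> v * c) * (p * \<phi> v * c) + (p * \<phi> v * s) * (p * \<phi> v * s)
      - (p * ((\<phi> v)\<^sup>2 / 2) + q) * p - p * (p * ((\<phi> v)\<^sup>2 / 2) + q)
      = p\<^sup>2 * (\<phi> v)\<^sup>2 * (c * c + s * s - 1) + - 2 * p * q" for c s
    by (simp add: field_simps power2_eq_square)
  from this[of "cos v" "sin v"]
  have E: "(p * \<phi> v * cos v) * (p * \<phi> v * cos v) + (p * \<phi> v * sin v) * (p * \<phi> v * sin v)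
      - (p * ((\<phi> v)\<^sup>2 / 2) + q) * p - p * (p * ((\<phi> v)\<^sup>2 / 2) + q) = 1"
    unfolding cs pq by simp
  have "(p * \<phi> v * c) * (f u * (r * c - \<phi> v * s))
      + (p * \<phi> v * s) * (f u * (r * s + \<phi> v * c)) - p * (f u * (\<phi> v * r))
      = p * \<phi> v * f u * r * (c * c + s * s - 1)" for c s
    by (simp add: field_simps power2_eq_square)
  from this[of "cos v" "sin v"]
  have F: "(p * \<phi> v * cos v) * (f u * (r * cos v - \<phi> v * sin v))
      + (p * \<phi> v * sin v) * (f u * (r * sin v + \<phi> v * cos v)) - p * (f u * (\<phi> v * r)) = 0"
    unfolding cs by simp
  have "(f u * (r * c - \<phi> v * s)) * (f u * (r * c - \<phi> v * s))
      + (f u * (r * s + \<phi> v * c)) * (f u * (r * s + \<phi> v * c))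
      = (f u)\<^sup>2 * (r\<^sup>2 + (\<phi> v)\<^sup>2) * (c * c + s * s)" for c s
    by (simp add: field_simps power2_eq_square)
  from this[of "cos v" "sin v"]
  have G: "(f u * (r * cos v - \<phi> v * sin v)) * (f u * (r * cos v - \<phi> v * sin v))
      + (f u * (r * sin v + \<phi> v * cos v)) * (f u * (r * sin v + \<phi> v * cos v))
      = (f u)\<^sup>2 * (r\<^sup>2 + (\<phi> v)\<^sup>2)"
    unfolding cs by simp
  have "mink (partial I J 1 (meridian_param f g \<phi>) u v) (partial I J 1 (meridian_param f g \<phi>) u v) = 1"
    unfolding zu mink_meridian_frame by (rule E)
  moreover have "mink (partial I J 1 (meridian_param f g \<phi>) u v) (partial I J 2 (meridian_param f g \<phi>) u v) = 0"
    unfolding zu zv mink_meridian_frame using F by simp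
  moreover have "mink (partial I J 2 (meridian_param f g \<phi>) u v) (partial I J 2 (meridian_param f g \<phi>) u v)
      = (f u)\<^sup>2 * (r\<^sup>2 + (\<phi> v)\<^sup>2)"
    unfolding zv mink_meridian_frame using G by simp
  moreover have "mink x y = mink y x" for x y
    by (simp add: mink_def mult.commute)
  ultimately show ?thesis
    unfolding induced_metric_def vec_eq_iff forall_2
    by (simp add: r_def)
qed

text \<open>This is the warped product formula with \<open>w\<close> equal to \<phi>'^2 + \<phi>^2;
  positivity of \<open>f\<close> and of this expression keeps the metric nondegenerate.\<close>

lemma gauss_curvature_parabolic_meridian_surface:
  assumes M: "parabolic_meridian_surface I J f g \<phi>" and "u \<in> I" "v \<in> J"
  shows "surface_gauss_curvature I J (meridian_param f g \<phi>) u v =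
    - deriv_on I (deriv_on I f) u / f u"
proof -
  note M' = M[unfolded parabolic_meridian_surface_def]
  show ?thesis
    unfolding surface_gauss_curvature_def
  proof (rule gauss_curvature_warped_product[OF _ _ induced_metric_meridian_param[OF M]])
    show "((\<lambda>v. (deriv_on J \<phi> v)\<^sup>2 + (\<phi> v)\<^sup>2) has_real_derivative
        2 * deriv_on J \<phi> v * deriv_on J (deriv_on J \<phi>) v + 2 * \<phi> v * deriv_on J \<phi> v) (at v within J)"
      if "v \<in> J" for v
      using M' that
      by (auto intro!: derivative_eq_intros smooth_on_interval_has_deriv_on_1
          smooth_on_interval_has_deriv_on_2)
  qed (use M' assms(2,3) in \<open>force intro: smooth_on_interval_has_deriv_on_1
          smooth_on_interval_has_deriv_on_2\<close>)+
qed


section \<open>The equation \<open>y'' = c y\<close> on an interval\<close>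

lemma deriv_on_zero_imp_constant:
  fixes h :: "real \<Rightarrow> real"
  assumes "is_interval S" and "\<And>x. x \<in> S \<Longrightarrow> (h has_real_derivative 0) (at x within S)"
  obtains c where "\<And>x. x \<in> S \<Longrightarrow> h x = c"
  using has_field_derivative_zero_constant[OF is_interval_convex[OF assms(1)], of h] assms(2) by blast

lemma second_deriv_on_trig_iff:
  fixes f :: "real \<Rightarrow> real"
  assumes S: "nondegenerate_interval S" and f: "smooth_on_interval S f" and "k \<noteq> 0"
  shows "(\<forall>x\<in>S. deriv_on S (deriv_on S f) x = - (k\<^sup>2 * f x)) \<longleftrightarrow>
    (\<exists>\<alpha> \<beta>. \<forall>x\<in>S. f x = \<alpha> * cos (k * x) + \<beta> * sin (k * x))"
proof
  assume ode: "\<forall>x\<in>S. deriv_on S (deriv_on S f) x = - (k\<^sup>2 * f x)"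
  note d = smooth_on_interval_has_deriv_on_1[OF f] smooth_on_interval_has_deriv_on_2[OF f]
  have int: "is_interval S"
    using S by (simp add: nondegenerate_interval_def)
  \<comment> \<open>\<alpha> and \<beta> come from solving f = \<alpha> cos(kx) + \<beta> sin(kx),
    f'/k = -\<alpha> sin(kx) + \<beta> cos(kx), that is, from rotating the pair (f, f'/k) by the
    angle kx. The equation for f'' makes both derivatives vanish.\<close>
  obtain \<alpha> where \<alpha>: "f x * cos (k * x) - deriv_on S f x * sin (k * x) / k = \<alpha>" if "x \<in> S" for x
    by (rule deriv_on_zero_imp_constant[OF int,
          where h = "\<lambda>x. f x * cos (k * x) - deriv_on S f x * sin (k * x) / k"])
       (use \<open>k \<noteq> 0\<close> ode in \<open>auto intro!: derivative_eq_intros d simp: field_simps power2_eq_square\<close>)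
  obtain \<beta> where \<beta>: "f x * sin (k * x) + deriv_on S f x * cos (k * x) / k = \<beta>" if "x \<in> S" for x
    by (rule deriv_on_zero_imp_constant[OF int,
          where h = "\<lambda>x. f x * sin (k * x) + deriv_on S f x * cos (k * x) / k"])
       (use \<open>k \<noteq> 0\<close> ode in \<open>auto intro!: derivative_eq_intros d simp: field_simps power2_eq_square\<close>)
  have "f x = \<alpha> * cos (k * x) + \<beta> * sin (k * x)" if "x \<in> S" for x
  proof -
    have "(a * c - b * s / k) * c + (a * s + b * c / k) * s = a * (s\<^sup>2 + c\<^sup>2)" for a b c s :: real
      by (simp add: algebra_simps power2_eq_square)
    from this[of "f x" "cos (k * x)" "deriv_on S f x" "sin (k * x)"] show ?thesis
      by (simp add: \<alpha>[OF that] \<beta>[OF that])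
  qed
  then show "\<exists>\<alpha> \<beta>. \<forall>x\<in>S. f x = \<alpha> * cos (k * x) + \<beta> * sin (k * x)" by blast
next
  assume "\<exists>\<alpha> \<beta>. \<forall>x\<in>S. f x = \<alpha> * cos (k * x) + \<beta> * sin (k * x)"
  then obtain \<alpha> \<beta> where *: "\<And>x. x \<in> S \<Longrightarrow> f x = \<alpha> * cos (k * x) + \<beta> * sin (k * x)" by blast
  \<comment> \<open>The closed form of \<open>f\<close> holds on \<open>S\<close> only, so each of
    the two differentiations first passes to it by \<open>deriv_on_cong\<close>.\<close>
  have 1: "deriv_on S f x = k * (\<beta> * cos (k * x) - \<alpha> * sin (k * x))" if "x \<in> S" for x
  proof -
    have "deriv_on S f x = deriv_on S (\<lambda>x. \<alpha> * cos (k * x) + \<beta> * sin (k * x)) x"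
      by (rule deriv_on_cong[OF that *])
    also have "\<dots> = k * (\<beta> * cos (k * x) - \<alpha> * sin (k * x))"
      by (rule deriv_on_real_eqI[OF S that]) (auto intro!: derivative_eq_intros simp: algebra_simps)
    finally show ?thesis .
  qed
  have "deriv_on S (deriv_on S f) x = - (k\<^sup>2 * f x)" if "x \<in> S" for x
  proof -
    have "deriv_on S (deriv_on S f) x = deriv_on S (\<lambda>x. k * (\<beta> * cos (k * x) - \<alpha> * sin (k * x))) x"
      by (rule deriv_on_cong[OF that 1])
    also have "\<dots> = - (k\<^sup>2 * f x)"
      by (rule deriv_on_real_eqI[OF S that])
         (auto intro!: derivative_eq_intros simp: *[OF that] algebra_simps power2_eq_square)
    finally show ?thesis .
  qed
  then show "\<forall>x\<in>S. deriv_on S (deriv_on S f) x = - (k\<^sup>2 * f x)" by blast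
qed

lemma second_deriv_on_hyperbolic_iff:
  fixes f :: "real \<Rightarrow> real"
  assumes S: "nondegenerate_interval S" and f: "smooth_on_interval S f" and "k \<noteq> 0"
  shows "(\<forall>x\<in>S. deriv_on S (deriv_on S f) x = k\<^sup>2 * f x) \<longleftrightarrow>
    (\<exists>\<alpha> \<beta>. \<forall>x\<in>S. f x = \<alpha> * cosh (k * x) + \<beta> * sinh (k * x))"
proof
  assume ode: "\<forall>x\<in>S. deriv_on S (deriv_on S f) x = k\<^sup>2 * f x"
  note d = smooth_on_interval_has_deriv_on_1[OF f] smooth_on_interval_has_deriv_on_2[OF f]
  have int: "is_interval S"
    using S by (simp add: nondegenerate_interval_def)
  \<comment> \<open>The system is now f = \<alpha> cosh(kx) + \<beta> sinh(kx), f'/k = \<alpha>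
    sinh(kx) + \<beta> cosh(kx). Its determinant cosh^2 - sinh^2 = 1 gives these
    coefficients.\<close>
  obtain \<alpha> where \<alpha>: "f x * cosh (k * x) - deriv_on S f x * sinh (k * x) / k = \<alpha>" if "x \<in> S" for x
    by (rule deriv_on_zero_imp_constant[OF int,
          where h = "\<lambda>x. f x * cosh (k * x) - deriv_on S f x * sinh (k * x) / k"])
       (use \<open>k \<noteq> 0\<close> ode in \<open>auto intro!: derivative_eq_intros d simp: field_simps power2_eq_square\<close>)
  obtain \<beta> where \<beta>: "deriv_on S f x * cosh (k * x) / k - f x * sinh (k * x) = \<beta>" if "x \<in> S" for x
    by (rule deriv_on_zero_imp_constant[OF int,
          where h = "\<lambda>x. deriv_on S f x * cosh (k * x) / k - f x * sinh (k * x)"])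
       (use \<open>k \<noteq> 0\<close> ode in \<open>auto intro!: derivative_eq_intros d simp: field_simps power2_eq_square\<close>)
  have "f x = \<alpha> * cosh (k * x) + \<beta> * sinh (k * x)" if "x \<in> S" for x
  proof -
    have "\<alpha> * cosh (k * x) + \<beta> * sinh (k * x) = f x * ((cosh (k * x))\<^sup>2 - (sinh (k * x))\<^sup>2)"
      unfolding \<alpha>[OF that, symmetric] \<beta>[OF that, symmetric]
      by (simp add: algebra_simps power2_eq_square)
    then show ?thesis by (simp add: cosh_square_eq)
  qed
  then show "\<exists>\<alpha> \<beta>. \<forall>x\<in>S. f x = \<alpha> * cosh (k * x) + \<beta> * sinh (k * x)" by blast
next
  assume "\<exists>\<alpha> \<beta>. \<forall>x\<in>S. f x = \<alpha> * cosh (k * x) + \<beta> * sinh (k * x)"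
  then obtain \<alpha> \<beta> where *: "\<And>x. x \<in> S \<Longrightarrow> f x = \<alpha> * cosh (k * x) + \<beta> * sinh (k * x)" by blast
  have 1: "deriv_on S f x = k * (\<beta> * cosh (k * x) + \<alpha> * sinh (k * x))" if "x \<in> S" for x
  proof -
    have "deriv_on S f x = deriv_on S (\<lambda>x. \<alpha> * cosh (k * x) + \<beta> * sinh (k * x)) x"
      by (rule deriv_on_cong[OF that *])
    also have "\<dots> = k * (\<beta> * cosh (k * x) + \<alpha> * sinh (k * x))"
      by (rule deriv_on_real_eqI[OF S that]) (auto intro!: derivative_eq_intros simp: algebra_simps)
    finally show ?thesis .
  qed
  have "deriv_on S (deriv_on S f) x = k\<^sup>2 * f x" if "x \<in> S" for x
  proof -
    have "deriv_on S (deriv_on S f) x = deriv_on S (\<lambda>x. k * (\<beta> * cosh (k * x) + \<alpha> * sinh (k * x))) x"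
      by (rule deriv_on_cong[OF that 1])
    also have "\<dots> = k\<^sup>2 * f x"
      by (rule deriv_on_real_eqI[OF S that])
         (auto intro!: derivative_eq_intros simp: *[OF that] algebra_simps power2_eq_square)
    finally show ?thesis .
  qed
  then show "\<forall>x\<in>S. deriv_on S (deriv_on S f) x = k\<^sup>2 * f x" by blast
qed

section \<open>Constant curvature and the shape of the meridian\<close>

theorem theorem3p1:
  fixes f g \<phi> :: "real \<Rightarrow> real" and I J :: "real set" and K :: real
  assumes "parabolic_meridian_surface I J f g \<phi>"
    and "general_class I J f \<phi>"
    and "K \<noteq> 0"
  shows "(\<forall>u\<in>I. \<forall>v\<in>J. surface_gauss_curvature I J (meridian_param f g \<phi>) u v = K) \<longleftrightarrow>
    (K > 0 \<longrightarrow> (\<exists>\<alpha> \<beta>. \<forall>u\<in>I. f u = \<alpha> * cos (sqrt K * u) + \<beta> * sin (sqrt K * u))) \<and>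
    (K < 0 \<longrightarrow> (\<exists>\<alpha> \<beta>. \<forall>u\<in>I. f u = \<alpha> * cosh (sqrt (- K) * u) + \<beta> * sinh (sqrt (- K) * u))) \<and>
    (\<forall>u\<in>I. (g has_real_derivative - 1 / (2 * deriv_on I f u)) (at u within I))"
proof -
  note M' = assms(1)[unfolded parabolic_meridian_surface_def]
  have I: "nondegenerate_interval I" and f: "smooth_on_interval I f" and g: "smooth_on_interval I g"
    and pos: "\<And>u. u \<in> I \<Longrightarrow> f u > 0"
    using M' by auto
  have "J \<noteq> {}"
    using M' by (auto simp: nondegenerate_interval_def)
  then have "(\<forall>u\<in>I. \<forall>v\<in>J. surface_gauss_curvature I J (meridian_param f g \<phi>) u v = K) \<longleftrightarrow>
      (\<forall>u\<in>I. - deriv_on I (deriv_on I f) u / f u = K)"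
    using gauss_curvature_parabolic_meridian_surface[OF assms(1)] by auto
  also have "\<dots> \<longleftrightarrow> (\<forall>u\<in>I. deriv_on I (deriv_on I f) u = - (K * f u))"
  proof (intro ball_cong refl)
    fix u assume "u \<in> I"
    then have "f u \<noteq> 0" using pos[of u] by simp
    then have "- deriv_on I (deriv_on I f) u / f u = K \<longleftrightarrow> - deriv_on I (deriv_on I f) u = K * f u"
      by (rule nonzero_divide_eq_eq)
    then show "- deriv_on I (deriv_on I f) u / f u = K \<longleftrightarrow> deriv_on I (deriv_on I f) u = - (K * f u)"
      by linarith
  qed
  \<comment> \<open>With \<open>k = sqrt K\<close> or \<open>k = sqrt (- K)\<close>, the square of
    \<open>k\<close> is \<open>K\<close> or \<open>- K\<close>. As \<open>K\<close> is nonzero,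
    exactly one implication is nonvacuous.\<close>
  also have "\<dots> \<longleftrightarrow>
      (K > 0 \<longrightarrow> (\<exists>\<alpha> \<beta>. \<forall>u\<in>I. f u = \<alpha> * cos (sqrt K * u) + \<beta> * sin (sqrt K * u))) \<and>
      (K < 0 \<longrightarrow> (\<exists>\<alpha> \<beta>. \<forall>u\<in>I. f u = \<alpha> * cosh (sqrt (- K) * u) + \<beta> * sinh (sqrt (- K) * u)))"
    using assms(3) second_deriv_on_trig_iff[OF I f, of "sqrt K"]
      second_deriv_on_hyperbolic_iff[OF I f, of "sqrt (- K)"]
    by (cases "K > 0") auto
  \<comment> \<open>The arc length condition alone forces this derivative, so the conjunct on
    \<open>g\<close> holds on every such surface. A zero of \<open>f'\<close> would turn that
    condition into 0 = 1.\<close>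
  moreover have "(g has_real_derivative - 1 / (2 * deriv_on I f u)) (at u within I)" if "u \<in> I" for u
  proof -
    have "- 2 * deriv_on I f u * deriv_on I g u = 1"
      using M' that by blast
    then have "deriv_on I g u = - 1 / (2 * deriv_on I f u)"
      by (cases "deriv_on I f u = 0") (auto simp: field_simps)
    then show ?thesis
      using smooth_on_interval_has_deriv_on_1[OF g that] by simp
  qed
  ultimately show ?thesis by blast
qed

end
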